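(* For any set $e\subset\mathbb{R}$ of Lebesgue measure zero there exists a measurable set $E\subset\mathbb{R}$ of finite Lebesgue measure such that $$H^*\mathbb{I}_E(x)=\infty\quad\text{for every } x\in e.$$
   Context: $\mathbb{I}_E$ denotes the indicator function of a set $E\subset\mathbb{R}$. For $f\in L^1(\mathbb{R})$, $x\in\mathbb{R}$ and $\varepsilon>0$ the truncated Hilbert transform is $$H_\varepsilon f(x)=\frac1\pi\int_{|t-x|>\varepsilon}\frac{f(t)}{x-t}\,dt,$$ and the maximal Hilbert transform is $H^*f(x)=\sup_{\varepsilon>0}|H_\varepsilon f(x)|\in[0,\infty]$. *)

theory Defs
  imports "HOL-Analysis.Analysis"
begin

text \<open>
  Both definitions are meant for integrable \<open>f\<close>.  In that case the integrand below is
  integrable on the truncated domain, because \<open>1 / (x - t)\<close> is bounded there by \<open>1 / \<epsilon>\<close>, so the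
  convention that the integral of a non-integrable function is 0 never comes into play.
\<close>

definition truncated_hilbert :: "real \<Rightarrow> (real \<Rightarrow> real) \<Rightarrow> real \<Rightarrow> real" where
  "truncated_hilbert \<epsilon> f x = 1 / pi * (LINT t:{t. \<bar>t - x\<bar> > \<epsilon>}|lebesgue. f t / (x - t))"

definition maximal_hilbert :: "(real \<Rightarrow> real) \<Rightarrow> real \<Rightarrow> ennreal" where
  "maximal_hilbert f x = (SUP \<epsilon>\<in>{0<..}. ennreal \<bar>truncated_hilbert \<epsilon> f x\<bar>)"

end

theory Submission
  imports Defs "HOL-Probability.Sinc_Integral"
begin

text \<open>
  The set \<open>E\<close> is produced from a measure.  Let \<open>\<mu> = \<Sum> m\<^sub>i \<delta>(b\<^sub>i)\<close> be a finite sum of positive point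
  masses on the line and \<open>R z = 1 + \<Sum> m\<^sub>i / (z - b\<^sub>i)\<close>.  On the upper half plane \<open>R\<close> has negative
  imaginary part, so \<open>ln R\<close> is defined there with argument between \<open>-\<pi>\<close> and \<open>0\<close>, and the boundary
  values of this argument are \<open>-\<pi>\<close> on \<open>E = {x. R x < 0}\<close> and \<open>0\<close> elsewhere.  Thus \<open>ln \<bar>R\<bar>\<close> is the conjugate
  Poisson integral of the indicator of \<open>E\<close>:
  
    \<open>\<integral>\<^sub>E (x - t) / ((x - t)\<^sup>2 + y\<^sup>2) dt = ln \<bar>R (x + \<i> y)\<bar>\<close>.
  
  For finitely many atoms this is elementary, since the zeros and poles of \<open>R\<close> interlace and \<open>E\<close> is
  the union of the intervals from a zero to the next pole (\<open>boole_set_intervals\<close>,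
  \<open>set_integral_conjugate_poisson_boole_set\<close>).  Moreover \<open>E\<close> has measure \<open>\<Sum> m\<^sub>i\<close>, which is Boole's
  identity (\<open>emeasure_boole_set\<close>).
  
  For infinitely many atoms of finite total mass, Boole's identity at other levels shows that
  adding atoms of small mass changes \<open>E\<close> by a set of small measure
  (\<open>emeasure_sym_diff_boole_set_le\<close>).  So the sets converge in measure and the formula persists
  (\<open>exists_set_with_log_cauchy_transform\<close>).
  
  The modulus of \<open>R (x + \<i> y)\<close> is at least that of its imaginary part, the Poisson extension
  \<open>\<Sum> m\<^sub>i y / ((x - b\<^sub>i)\<^sup>2 + y\<^sup>2)\<close>.  For a null set \<open>e\<close> there is a finite \<open>\<mu>\<close> whose Poisson extension is
  unbounded above each point of \<open>e\<close>: cover \<open>e\<close> by very short intervals again and again, and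
  give each interval an atom that is heavy compared with its length (\<open>null_set_heavy_atoms\<close>).  Then
  the conjugate Poisson integrals of the indicator of \<open>E\<close> are unbounded above each point of \<open>e\<close>, and
  so are the truncated Hilbert transforms, which differ from them by a bounded amount
  (\<open>truncated_hilbert_indicator_near_conjugate_poisson\<close>).
\<close>

section \<open>Rational functions with positive residues at real poles\<close>

lemma sign_change_imp_zero:
  fixes f :: "real \<Rightarrow> real"
  assumes "u < v" "f u * f v < 0" "continuous_on UNIV f"
  obtains x where "u < x" "x < v" "f x = 0"
proof -
  have c: "continuous_on {u..v} f" using assms(3) continuous_on_subset by blast
  have "\<exists>x\<ge>u. x \<le> v \<and> f x = 0"
  proof (cases "f u < 0")
    case True
    then show ?thesis using IVT'[of f u 0 v] c assms by (auto simp: mult_less_0_iff)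
  next
    case False
    then show ?thesis using IVT2'[of f v 0 u] c assms by (auto simp: mult_less_0_iff)
  qed
  then obtain x where "u \<le> x" "x \<le> v" "f x = 0" by blast
  then show ?thesis using assms(2) that[of x] by (cases "x = u"; cases "x = v") auto
qed

text \<open>
  Cleared of denominators, \<open>1 + \<Sum> m\<^sub>i / (z - b\<^sub>i)\<close> becomes a monic polynomial of degree \<open>n\<close>.  Because
  the residues are positive, its signs alternate along the poles, and far to the left it has the
  sign opposite to the one at \<open>b\<^sub>0\<close>.  The intermediate value theorem then gives one zero just to
  the left of each pole; these are \<open>n\<close> distinct zeros, hence all of them, and the polynomial is
  the product of its linear factors.
\<close>

lemma partial_fraction_zeros_interlace:
  fixes b m :: "nat \<Rightarrow> real"
  assumes b: "\<And>i j. i < j \<Longrightarrow> j < n \<Longrightarrow> b i < b j" and m: "\<And>i. i < n \<Longrightarrow> 0 < m i"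
  obtains a where "\<And>i. i < n \<Longrightarrow> a i < b i" "\<And>i j. i < j \<Longrightarrow> j < n \<Longrightarrow> b i < a j"
    "\<And>z::complex. z \<notin> (\<lambda>i. of_real (b i)) ` {..<n} \<Longrightarrow>
       1 + (\<Sum>i<n. m i / (z - b i)) = (\<Prod>i<n. (z - a i) / (z - b i))"
proof -
  define f where "f t = (\<Prod>i<n. t - b i) + (\<Sum>i<n. m i * (\<Prod>j\<in>{..<n}-{i}. t - b j))" for t
  define p where "p = (\<Prod>i<n. [:- complex_of_real (b i), 1:]) +
     (\<Sum>i<n. smult (complex_of_real (m i)) (\<Prod>j\<in>{..<n}-{i}. [:- complex_of_real (b j), 1:]))"
  have pf: "poly p (complex_of_real t) = complex_of_real (f t)" for t
    by (simp add: p_def f_def poly_prod poly_sum)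
  have fb: "f (b i) = m i * (\<Prod>j\<in>{..<n}-{i}. b i - b j)" if "i < n" for i
  proof -
    have "(\<Prod>j<n. b i - b j) = 0" using that by auto
    moreover have "(\<Prod>j\<in>{..<n}-{k}. b i - b j) = 0" if "k \<noteq> i" for k
      using that \<open>i < n\<close> by auto
    then have "(\<Sum>k<n. m k * (\<Prod>j\<in>{..<n}-{k}. b i - b j)) =
        (\<Sum>k\<in>{i}. m k * (\<Prod>j\<in>{..<n}-{k}. b i - b j))"
      using that by (intro sum.mono_neutral_right) auto
    ultimately show ?thesis by (simp add: f_def)
  qed
  have cont: "continuous_on UNIV f"
    unfolding f_def by (intro continuous_intros)
  have ex: "\<exists>x. f x = 0 \<and> x < b i \<and> (\<forall>j<i. b j < x)" if "i < n" for i
  proof (cases i)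
    case 0
    define s where "s = (\<Sum>i<n. m i)"
    \<comment> \<open>So far to the left of all poles that the sum of fractions is
      greater than \<open>-1\<close>.\<close>
    define x where "x = b 0 - (1 + s)"
    have s: "s \<ge> 0" unfolding s_def using m by (intro sum_nonneg) (auto intro: less_imp_le)
    have b0: "b 0 \<le> b j" if "j < n" for j using b[of 0 j] that by (cases "j = 0") auto
    have xb: "1 + s \<le> b j - x" if "j < n" for j using b0[OF that] by (simp add: x_def)
    have "m j / (b j - x) \<le> m j / (1 + s)" if "j < n" for j
      using xb[OF that] m[OF that] s by (intro divide_left_mono) auto
    then have "(\<Sum>j<n. m j / (b j - x)) \<le> (\<Sum>j<n. m j / (1 + s))" by (intro sum_mono) auto
    also have "\<dots> = s / (1 + s)" by (simp add: s_def sum_divide_distrib)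
    also have "\<dots> < 1" using s by simp
    finally have lt: "(\<Sum>j<n. m j / (b j - x)) < 1" .
    have "f x = (\<Prod>j<n. x - b j) * (1 - (\<Sum>j<n. m j / (b j - x)))"
    proof -
      have "m k * (\<Prod>j\<in>{..<n}-{k}. x - b j) = - ((\<Prod>j<n. x - b j) * (m k / (b k - x)))" if "k < n" for k
      proof -
        have P: "(\<Prod>j<n. x - b j) = (x - b k) * (\<Prod>j\<in>{..<n}-{k}. x - b j)"
          using that by (intro prod.remove) auto
        have "b k - x \<noteq> 0" using xb[OF that] s by auto
        then show ?thesis unfolding P by (simp add: field_simps)
      qed
      then show ?thesis
        by (simp add: f_def right_diff_distrib sum_distrib_left sum_negf)
    qed
    also have "(\<Prod>j<n. x - b j) = (x - b 0) * (\<Prod>j\<in>{..<n}-{0}. x - b j)"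
      using \<open>i < n\<close> 0 by (intro prod.remove) auto
    finally have "f x * f (b 0) = (1 - (\<Sum>j<n. m j / (b j - x))) * m 0 * (x - b 0) *
        (\<Prod>j\<in>{..<n}-{0}. (x - b j) * (b 0 - b j))"
      using fb[of 0] \<open>i < n\<close> 0 by (simp add: prod.distrib)
    moreover have "(\<Prod>j\<in>{..<n}-{0}. (x - b j) * (b 0 - b j)) > 0"
      using b[of 0] xb s by (intro prod_pos) (force intro!: mult_neg_neg)
    moreover have "x - b 0 < 0" using s by (simp add: x_def)
    moreover have "m 0 > 0" using m[of 0] \<open>i < n\<close> 0 by simp
    ultimately have "f x * f (b 0) < 0" using lt by (simp add: mult_less_0_iff zero_less_mult_iff)
    then obtain y where "x < y" "y < b 0" "f y = 0"
      using sign_change_imp_zero[of x "b 0" f] cont \<open>x - b 0 < 0\<close> by auto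
    then show ?thesis using 0 by auto
  next
    case (Suc k)
    let ?R = "{..<n} - {k} - {Suc k}"
    \<comment> \<open>At two neighbouring poles every other factor has the same sign, so that only
      the factors coming from the two poles themselves decide the sign of the product.\<close>
    have "f (b k) = m k * ((b k - b (Suc k)) * (\<Prod>j\<in>?R. b k - b j))"
      using fb[of k] that Suc prod.remove[of "{..<n} - {k}" "Suc k" "\<lambda>j. b k - b j"] by auto
    moreover have "f (b (Suc k)) = m (Suc k) * ((b (Suc k) - b k) * (\<Prod>j\<in>?R. b (Suc k) - b j))"
    proof -
      have eq: "?R = {..<n} - {Suc k} - {k}" by auto
      show ?thesis unfolding eq
        using fb[of "Suc k"] that Suc prod.remove[of "{..<n} - {Suc k}" k "\<lambda>j. b (Suc k) - b j"]
        by auto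
    qed
    ultimately have "f (b k) * f (b (Suc k)) = (m k * m (Suc k)) *
       ((b k - b (Suc k)) * (b (Suc k) - b k) * (\<Prod>j\<in>?R. (b k - b j) * (b (Suc k) - b j)))"
      by (simp add: prod.distrib)
    moreover have "(\<Prod>j\<in>?R. (b k - b j) * (b (Suc k) - b j)) > 0"
    proof (intro prod_pos)
      fix j assume j: "j \<in> ?R"
      then consider "j < k" | "Suc k < j" by fastforce
      then show "(b k - b j) * (b (Suc k) - b j) > 0"
        using b[of j k] b[of j "Suc k"] b[of k j] b[of "Suc k" j] that Suc j
        by cases (auto intro!: mult_pos_pos mult_neg_neg)
    qed
    moreover have "m k > 0" "m (Suc k) > 0" "b k < b (Suc k)" using m b that Suc by auto
    ultimately have "f (b k) * f (b (Suc k)) < 0"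
      by (simp add: mult_less_0_iff zero_less_mult_iff)
    then obtain y where y: "b k < y" "y < b (Suc k)" "f y = 0"
      using sign_change_imp_zero[of "b k" "b (Suc k)" f] cont \<open>b k < b (Suc k)\<close> by auto
    moreover have "b j < y" if "j < i" for j
    proof -
      have "b j \<le> b k" using b[of j k] that Suc \<open>i < n\<close> by (cases "j = k") auto
      then show ?thesis using y by simp
    qed
    ultimately show ?thesis using Suc by auto
  qed
  then obtain a where a: "\<And>i. i < n \<Longrightarrow> f (a i) = 0" "\<And>i. i < n \<Longrightarrow> a i < b i"
    "\<And>i j. i < j \<Longrightarrow> j < n \<Longrightarrow> b i < a j" by metis
  have aa: "a i < a j" if "i < j" "j < n" for i j using a(2)[of i] a(3)[of i j] that by simp
  have inj: "inj_on (\<lambda>i. complex_of_real (a i)) {..<n}"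
    by (intro inj_onI) (metis aa lessThan_iff less_irrefl linorder_neqE_nat of_real_eq_iff)
  define q where "q = (\<Prod>i<n. [:- complex_of_real (a i), 1:])"
  have deg: "degree (\<Prod>i\<in>I. [:- complex_of_real (c i), 1:]) = card I"
    and lead: "coeff (\<Prod>i\<in>I. [:- complex_of_real (c i), 1:]) (card I) = 1" if "finite I" for c and I :: "nat set"
  proof -
    show *: "degree (\<Prod>i\<in>I. [:- complex_of_real (c i), 1:]) = card I"
      by (subst degree_prod_eq_sum_degree) auto
    have "lead_coeff (\<Prod>i\<in>I. [:- complex_of_real (c i), 1:]) = 1"
      by (subst lead_coeff_prod) auto
    then show "coeff (\<Prod>i\<in>I. [:- complex_of_real (c i), 1:]) (card I) = 1" using * by simp
  qed
  have dlt: "degree (smult (complex_of_real (m i)) (\<Prod>j\<in>{..<n}-{i}. [:- complex_of_real (b j), 1:])) < n"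
    if "i < n" for i
    by (rule le_less_trans[OF degree_smult_le]) (use that deg[of "{..<n}-{i}"] in auto)
  have "(\<Sum>i<n. coeff (smult (complex_of_real (m i)) (\<Prod>j\<in>{..<n}-{i}. [:- complex_of_real (b j), 1:])) n) = 0"
    by (intro sum.neutral ballI coeff_eq_0 dlt) auto
  then have "coeff p n = 1"
    using lead[of "{..<n}" b] by (simp add: p_def coeff_sum del: coeff_smult)
  moreover have "degree p \<le> n"
    unfolding p_def using deg[of "{..<n}" b] less_imp_le[OF dlt]
    by (intro degree_add_le degree_sum_le) (auto simp del: degree_smult_eq)
  moreover have "coeff q n = 1" "degree q \<le> n"
    using lead[of "{..<n}" a] deg[of "{..<n}" a] by (auto simp: q_def)
  moreover have "card ((\<lambda>i. complex_of_real (a i)) ` {..<n}) \<ge> n"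
    using inj by (simp add: card_image)
  moreover have "poly p z = poly q z" if "z \<in> (\<lambda>i. complex_of_real (a i)) ` {..<n}" for z
    using that by (auto simp: pf a q_def poly_prod)
  ultimately have pq: "p = q"
    by (intro poly_eqI_degree_lead_coeff[of p n q]) auto
  show ?thesis
  proof (rule that[of a])
    fix z :: complex assume "z \<notin> (\<lambda>i. of_real (b i)) ` {..<n}"
    then have z: "z \<noteq> b i" if "i < n" for i using that by auto
    let ?P = "\<Prod>i<n. z - b i"
    have nz: "?P \<noteq> 0" using z by auto
    have "?P * (m k / (z - b k)) = m k * (\<Prod>j\<in>{..<n}-{k}. z - b j)" if "k < n" for k
    proof -
      have P: "?P = (z - b k) * (\<Prod>j\<in>{..<n}-{k}. z - b j)"
        using that by (intro prod.remove) auto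
      show ?thesis unfolding P using z[OF that] by simp
    qed
    then have "?P * (1 + (\<Sum>i<n. m i / (z - b i))) = poly p z"
      by (simp add: p_def poly_prod poly_sum distrib_left sum_distrib_left)
    also have "\<dots> = (\<Prod>i<n. z - a i)" by (simp add: pq q_def poly_prod)
    also have "\<dots> = ?P * (\<Prod>i<n. (z - a i) / (z - b i))"
      using nz by (simp add: prod_dividef)
    finally show "1 + (\<Sum>i<n. m i / (z - b i)) = (\<Prod>i<n. (z - a i) / (z - b i))"
      using nz by simp
  qed (use a in auto)
qed

text \<open>
  The poles are excluded because the convention \<open>u / 0 = 0\<close> would assign them a meaningless value
  of the sum.
\<close>

definition boole_set :: "'i set \<Rightarrow> ('i \<Rightarrow> real) \<Rightarrow> ('i \<Rightarrow> real) \<Rightarrow> real \<Rightarrow> real set" where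
  "boole_set I b m c = {x. x \<notin> b ` I \<and> c + (\<Sum>i\<in>I. m i / (x - b i)) < 0}"

lemma tendsto_const_over_shift: "((\<lambda>x::real. c / (x - b)) \<longlongrightarrow> 0) at_top"
proof -
  have "filterlim (\<lambda>x. - b + x) at_top at_top"
    by (intro filterlim_tendsto_add_at_top[OF tendsto_const] filterlim_ident)
  from real_tendsto_divide_at_top[OF tendsto_const this, of c] show ?thesis by simp
qed

lemma tendsto_times_over_shift: "((\<lambda>x::real. c * (x / (x - b))) \<longlongrightarrow> c) at_top"
proof -
  have "((\<lambda>x. c * (1 + b / (x - b))) \<longlongrightarrow> c * (1 + 0)) at_top"
    by (intro tendsto_intros tendsto_const_over_shift)
  moreover have "\<forall>\<^sub>F x in at_top. c * (1 + b / (x - b)) = c * (x / (x - b))"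
    using eventually_gt_at_top[of b] by eventually_elim (simp add: field_simps)
  ultimately show ?thesis by (simp add: Lim_transform_eventually)
qed

text \<open>
  The coefficient of \<open>1 / x\<close> in the expansion of \<open>\<Prod> (x - a\<^sub>i) / (x - b\<^sub>i)\<close> at infinity.  It is compared
  below with the sum of the residues of the same function.
\<close>

lemma tendsto_times_prod_minus_one:
  fixes a b :: "nat \<Rightarrow> real"
  shows "((\<lambda>x. \<Prod>i<n. (x - a i) / (x - b i)) \<longlongrightarrow> 1) at_top \<and>
    ((\<lambda>x. x * ((\<Prod>i<n. (x - a i) / (x - b i)) - 1)) \<longlongrightarrow> (\<Sum>i<n. b i - a i)) at_top"
proof (induction n)
  case 0
  then show ?case by simp
next
  case (Suc n)
  define P where "P x = (\<Prod>i<n. (x - a i) / (x - b i))" for x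
  define Q where "Q x = (x - a n) / (x - b n)" for x
  have "((\<lambda>x. x * (Q x - 1)) \<longlongrightarrow> b n - a n) at_top"
  proof (rule Lim_transform_eventually[OF tendsto_times_over_shift[of "b n - a n" "b n"]])
    show "\<forall>\<^sub>F x in at_top. (b n - a n) * (x / (x - b n)) = x * (Q x - 1)"
      using eventually_gt_at_top[of "b n"] unfolding Q_def
      by eventually_elim (simp add: field_simps)
  qed
  moreover have Q1: "(Q \<longlongrightarrow> 1) at_top"
  proof (rule Lim_transform_eventually)
    show "((\<lambda>x. 1 + (b n - a n) / (x - b n)) \<longlongrightarrow> 1) at_top"
      using tendsto_add[OF tendsto_const[of 1] tendsto_const_over_shift[of "b n - a n" "b n"]] by simp
    show "\<forall>\<^sub>F x in at_top. 1 + (b n - a n) / (x - b n) = Q x"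
      using eventually_gt_at_top[of "b n"] unfolding Q_def
      by eventually_elim (simp add: field_simps)
  qed
  moreover have P: "(P \<longlongrightarrow> 1) at_top" "((\<lambda>x. x * (P x - 1)) \<longlongrightarrow> (\<Sum>i<n. b i - a i)) at_top"
    using Suc.IH by (simp_all add: P_def[abs_def])
  ultimately have "((\<lambda>x. x * (P x - 1) * Q x + x * (Q x - 1)) \<longlongrightarrow> (\<Sum>i<n. b i - a i) * 1 + (b n - a n)) at_top"
    by (intro tendsto_intros)
  then have "((\<lambda>x. x * (P x * Q x - 1)) \<longlongrightarrow> (\<Sum>i<Suc n. b i - a i)) at_top"
    by (simp add: algebra_simps)
  moreover have "((\<lambda>x. P x * Q x) \<longlongrightarrow> 1 * 1) at_top"
    by (intro tendsto_intros P Q1)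
  ultimately show ?case by (simp add: P_def Q_def)
qed

text \<open>
  By the factorisation, the function is negative exactly between a zero and the pole that follows
  it: there one quotient \<open>(x - \<alpha>\<^sub>i) / (x - \<beta>\<^sub>i)\<close> is negative and the others are positive.  The total
  length of these intervals and the sum of the residues are both the coefficient of \<open>1 / x\<close> at
  infinity.  The \<open>b i\<close> may coincide; the poles \<open>\<beta>\<close> are their distinct values in increasing order, each
  carrying the sum of the residues that fall on it.
\<close>

lemma boole_set_intervals:
  fixes b m :: "'i \<Rightarrow> real"
  assumes I: "finite I" and m: "\<And>i. i \<in> I \<Longrightarrow> 0 < m i"
  obtains n :: nat and \<alpha> \<beta> :: "nat \<Rightarrow> real" where
    "\<forall>i<n. \<alpha> i < \<beta> i" "\<forall>i j. i < j \<longrightarrow> j < n \<longrightarrow> \<beta> i < \<alpha> j"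
    "boole_set I b m 1 = (\<Union>i<n. {\<alpha> i<..<\<beta> i})"
    "(\<Sum>i<n. \<beta> i - \<alpha> i) = sum m I"
    "\<forall>z::complex. Im z \<noteq> 0 \<longrightarrow> 1 + (\<Sum>i\<in>I. m i / (z - b i)) = (\<Prod>i<n. (z - \<alpha> i) / (z - \<beta> i))"
proof -
  define B where "B = b ` I"
  define n where "n = card B"
  define \<beta> where "\<beta> = (!) (sorted_list_of_set B)"
  define w where "w x = sum m {i \<in> I. b i = x}" for x
  have B: "finite B" using I by (simp add: B_def)
  have \<beta>less: "\<beta> i < \<beta> j" if "i < j" "j < n" for i j
    unfolding \<beta>_def using that B sorted_wrt_nth_less[OF strict_sorted_list_of_set, of i j B]
    by (simp add: n_def)
  have bij: "bij_betw \<beta> {..<n} B"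
    unfolding \<beta>_def n_def using B
    by (intro bij_betw_nth) auto
  have \<beta>B: "\<beta> i \<in> B" if "i < n" for i using bij that by (auto simp: bij_betw_def)
  have wpos: "0 < w x" if "x \<in> B" for x
    unfolding w_def using that I m by (intro sum_pos) (auto simp: B_def)
  have merge: "(\<Sum>i\<in>I. m i / (z - b i)) = (\<Sum>k<n. w (\<beta> k) / (z - \<beta> k))" for z :: complex
  proof -
    have "(\<Sum>i\<in>I. m i / (z - b i)) = (\<Sum>x\<in>B. \<Sum>i\<in>{i \<in> I. b i = x}. m i / (z - b i))"
      unfolding B_def by (rule sum.image_gen[OF I])
    also have "\<dots> = (\<Sum>x\<in>B. w x / (z - x))"
      by (intro sum.cong refl) (simp add: w_def sum_divide_distrib)
    also have "\<dots> = (\<Sum>k<n. w (\<beta> k) / (z - \<beta> k))"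
      by (rule sum.reindex_bij_betw[OF bij, symmetric])
    finally show ?thesis .
  qed
  obtain \<alpha> where \<alpha>: "\<And>i. i < n \<Longrightarrow> \<alpha> i < \<beta> i" "\<And>i j. i < j \<Longrightarrow> j < n \<Longrightarrow> \<beta> i < \<alpha> j"
    "\<And>z::complex. z \<notin> (\<lambda>i. of_real (\<beta> i)) ` {..<n} \<Longrightarrow>
       1 + (\<Sum>i<n. w (\<beta> i) / (z - \<beta> i)) = (\<Prod>i<n. (z - \<alpha> i) / (z - \<beta> i))"
  proof (rule partial_fraction_zeros_interlace[of n \<beta> "\<lambda>i. w (\<beta> i)"])
    show "\<beta> i < \<beta> j" if "i < j" "j < n" for i j using \<beta>less that .
    show "0 < w (\<beta> i)" if "i < n" for i using wpos[OF \<beta>B[OF that]] .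
  qed (rule that)
  have prod_real: "1 + (\<Sum>i\<in>I. m i / (x - b i)) = (\<Prod>i<n. (x - \<alpha> i) / (x - \<beta> i))" if "x \<notin> B" for x
  proof -
    have "1 + (\<Sum>i\<in>I. m i / (complex_of_real x - b i)) = (\<Prod>i<n. (complex_of_real x - \<alpha> i) / (complex_of_real x - \<beta> i))"
      unfolding merge using that \<beta>B by (intro \<alpha>(3)) auto
    then have "complex_of_real (1 + (\<Sum>i\<in>I. m i / (x - b i))) = complex_of_real (\<Prod>i<n. (x - \<alpha> i) / (x - \<beta> i))"
      by simp
    then show ?thesis by (simp only: of_real_eq_iff)
  qed
  have factor: "(x - \<alpha> j) / (x - \<beta> j) > 0" if "j < n" "x < \<alpha> j \<or> \<beta> j < x" for x j
    using that \<alpha>(1)[of j] by (auto simp: zero_less_divide_iff)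
  have "boole_set I b m 1 = (\<Union>i<n. {\<alpha> i<..<\<beta> i})"
  proof (intro set_eqI iffI)
    fix x assume "x \<in> (\<Union>i<n. {\<alpha> i<..<\<beta> i})"
    then obtain i where i: "i < n" "\<alpha> i < x" "x < \<beta> i" by auto
    have out: "x < \<alpha> j \<or> \<beta> j < x" if "j < n" "j \<noteq> i" for j
      using \<alpha>(2)[of i j] \<alpha>(2)[of j i] i that by (cases "j < i") auto
    have xB: "x \<notin> B"
    proof
      assume "x \<in> B"
      then obtain j where "j < n" "x = \<beta> j" using bij by (auto simp: bij_betw_def)
      then show False using out[of j] i \<alpha>(1)[of j] by (cases "j = i") auto
    qed
    have "(\<Prod>j<n. (x - \<alpha> j) / (x - \<beta> j)) =
        (x - \<alpha> i) / (x - \<beta> i) * (\<Prod>j\<in>{..<n}-{i}. (x - \<alpha> j) / (x - \<beta> j))"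
      using i by (intro prod.remove) auto
    moreover have "(\<Prod>j\<in>{..<n}-{i}. (x - \<alpha> j) / (x - \<beta> j)) > 0"
      using factor out by (intro prod_pos) auto
    moreover have "(x - \<alpha> i) / (x - \<beta> i) < 0" using i by (simp add: divide_less_0_iff)
    ultimately have "(\<Prod>j<n. (x - \<alpha> j) / (x - \<beta> j)) < 0" by (metis mult_neg_pos)
    then show "x \<in> boole_set I b m 1"
      using prod_real[of x] xB by (simp add: boole_set_def B_def)
  next
    fix x assume x: "x \<in> boole_set I b m 1"
    then have xB: "x \<notin> B" and neg: "(\<Prod>i<n. (x - \<alpha> i) / (x - \<beta> i)) < 0"
      using prod_real[of x] by (auto simp: boole_set_def B_def)
    show "x \<in> (\<Union>i<n. {\<alpha> i<..<\<beta> i})"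
    proof (rule ccontr)
      assume no: "x \<notin> (\<Union>i<n. {\<alpha> i<..<\<beta> i})"
      have "(x - \<alpha> i) / (x - \<beta> i) \<ge> 0" if "i < n" for i
      proof -
        have "x \<noteq> \<beta> i" using xB \<beta>B that by auto
        then have "x \<le> \<alpha> i \<or> \<beta> i < x" using no that by force
        then show ?thesis using \<alpha>(1)[of i] that by (auto simp: zero_le_divide_iff)
      qed
      then have "(\<Prod>i<n. (x - \<alpha> i) / (x - \<beta> i)) \<ge> 0" by (intro prod_nonneg) auto
      then show False using neg by simp
    qed
  qed
  moreover have "(\<Sum>i<n. \<beta> i - \<alpha> i) = sum m I"
  proof -
    have "((\<lambda>x. \<Sum>i\<in>I. m i * (x / (x - b i))) \<longlongrightarrow> sum m I) at_top"
      by (intro tendsto_sum tendsto_times_over_shift)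
    moreover have "\<forall>\<^sub>F x in at_top. (\<Sum>i\<in>I. m i * (x / (x - b i))) =
        x * ((\<Prod>i<n. (x - \<alpha> i) / (x - \<beta> i)) - 1)"
    proof -
      have "\<forall>\<^sub>F x in at_top. \<forall>c\<in>B. c < x"
        using B by (intro eventually_ball_finite ballI eventually_gt_at_top) auto
      then show ?thesis
      proof eventually_elim
        case (elim x)
        then have "x \<notin> B" by auto
        then have "(\<Prod>i<n. (x - \<alpha> i) / (x - \<beta> i)) - 1 = (\<Sum>i\<in>I. m i / (x - b i))"
          using prod_real[of x] by simp
        then show ?case by (simp add: sum_distrib_left mult_ac)
      qed
    qed
    ultimately have "((\<lambda>x. x * ((\<Prod>i<n. (x - \<alpha> i) / (x - \<beta> i)) - 1)) \<longlongrightarrow> sum m I) at_top"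
      by (rule Lim_transform_eventually)
    then show ?thesis
      using tendsto_times_prod_minus_one[of \<alpha> \<beta> n]
      by (intro tendsto_unique[OF trivial_limit_at_top_linorder]) auto
  qed
  moreover have "1 + (\<Sum>i\<in>I. m i / (z - b i)) = (\<Prod>i<n. (z - \<alpha> i) / (z - \<beta> i))" if "Im z \<noteq> 0" for z :: complex
    unfolding merge using that by (intro \<alpha>(3)) auto
  ultimately show ?thesis using \<alpha>(1,2) by (intro that[of n \<alpha> \<beta>]) auto
qed

section \<open>Boole's identity and the logarithm of a Cauchy transform\<close>

lemma sets_boole_set [measurable]:
  fixes b m :: "'i \<Rightarrow> real"
  assumes "finite I"
  shows "boole_set I b m c \<in> sets borel"
proof -
  have "boole_set I b m c = {x \<in> space borel. (\<forall>i\<in>I. x \<noteq> b i) \<and> c + (\<Sum>i\<in>I. m i / (x - b i)) < 0}"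
    by (auto simp: boole_set_def)
  also have "\<dots> \<in> sets borel" using assms by measurable
  finally show ?thesis .
qed

lemma disjoint_interlacing_intervals:
  fixes \<alpha> \<beta> :: "nat \<Rightarrow> real"
  assumes "\<And>i j. i < j \<Longrightarrow> j < n \<Longrightarrow> \<beta> i < \<alpha> j"
  shows "disjoint_family_on (\<lambda>i. {\<alpha> i<..<\<beta> i}) {..<n}"
  unfolding disjoint_family_on_def
proof (intro ballI impI)
  fix i j :: nat assume "i \<in> {..<n}" "j \<in> {..<n}" "i \<noteq> j"
  then have "\<beta> i < \<alpha> j \<or> \<beta> j < \<alpha> i" using assms by (metis lessThan_iff linorder_neqE_nat)
  then show "{\<alpha> i<..<\<beta> i} \<inter> {\<alpha> j<..<\<beta> j} = {}" by auto
qed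

text \<open>
  Boole's identity.  That the measure depends on the total mass and the level only, and not on the
  position of the poles, is what makes all later estimates uniform in the number of poles.
\<close>

lemma emeasure_boole_set:
  fixes b m :: "'i \<Rightarrow> real"
  assumes I: "finite I" and m: "\<And>i. i \<in> I \<Longrightarrow> 0 < m i" and c: "0 < c"
  shows "emeasure lborel (boole_set I b m c) = ennreal (sum m I / c)"
proof -
  have scale: "boole_set I b m c = boole_set I b (\<lambda>i. m i / c) 1"
  proof -
    have "c + (\<Sum>i\<in>I. m i / (x - b i)) = c * (1 + (\<Sum>i\<in>I. m i / c / (x - b i)))" for x
      using c by (simp add: distrib_left sum_distrib_left)
    then show ?thesis using c by (simp add: boole_set_def mult_less_0_iff)
  qed
  have "\<And>i. i \<in> I \<Longrightarrow> 0 < m i / c" using m c by simp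
  then obtain n :: nat and \<alpha> \<beta> where ab: "\<forall>i<n. \<alpha> i < \<beta> i"
    "\<forall>i j. i < j \<longrightarrow> j < n \<longrightarrow> \<beta> i < \<alpha> j"
    "boole_set I b (\<lambda>i. m i / c) 1 = (\<Union>i<n. {\<alpha> i<..<\<beta> i})"
    "(\<Sum>i<n. \<beta> i - \<alpha> i) = (\<Sum>i\<in>I. m i / c)"
    by (rule boole_set_intervals[OF I, of "\<lambda>i. m i / c" b])
  have "emeasure lborel (\<Union>i<n. {\<alpha> i<..<\<beta> i}) = (\<Sum>i<n. emeasure lborel {\<alpha> i<..<\<beta> i})"
    using disjoint_interlacing_intervals[of n \<beta> \<alpha>] ab(2) by (intro sum_emeasure[symmetric]) auto
  also have "\<dots> = (\<Sum>i<n. ennreal (\<beta> i - \<alpha> i))"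
    using ab(1) by (intro sum.cong refl) (auto intro: less_imp_le)
  also have "\<dots> = ennreal (\<Sum>i<n. \<beta> i - \<alpha> i)"
    using ab(1) by (intro sum_ennreal) (auto intro: less_imp_le)
  finally show ?thesis using scale ab by (simp add: sum_divide_distrib)
qed

lemma measure_boole_set:
  fixes b m :: "'i \<Rightarrow> real"
  assumes "finite I" "\<And>i. i \<in> I \<Longrightarrow> 0 < m i" "0 < c"
  shows "measure lborel (boole_set I b m c) = sum m I / c"
proof -
  have "0 \<le> sum m I" using assms by (intro sum_nonneg) (auto intro: less_imp_le)
  then show ?thesis using emeasure_boole_set[of I m c b] assms by (simp add: measure_def)
qed

lemma set_integral_conjugate_poisson_interval:
  fixes x y :: real
  assumes y: "y > 0" and ab: "a < b"
  shows "(LINT t:{a<..<b}|lborel. (x - t) / ((x - t)\<^sup>2 + y\<^sup>2)) =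
    ln (cmod ((Complex x y - a) / (Complex x y - b)))"
proof -
  define F where "F t = - (1/2) * ln ((x - t)\<^sup>2 + y\<^sup>2)" for t
  have pos: "(x - t)\<^sup>2 + y\<^sup>2 > 0" for t using y by (intro add_nonneg_pos) auto
  have nz: "(x - t)\<^sup>2 + y\<^sup>2 \<noteq> 0" for t using pos[of t] by linarith
  have ln_cmod: "ln (cmod (Complex x y - t)) = - F t" for t
    using pos[of t] y by (simp add: F_def cmod_def ln_sqrt)
  have "(LBINT t=a..b. (x - t) / ((x - t)\<^sup>2 + y\<^sup>2)) = F b - F a"
  proof (rule interval_integral_FTC_finite)
    show "continuous_on {min a b..max a b} (\<lambda>t. (x - t) / ((x - t)\<^sup>2 + y\<^sup>2))"
      using nz by (intro continuous_intros) auto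
    show "(F has_vector_derivative (x - t) / ((x - t)\<^sup>2 + y\<^sup>2)) (at t within {min a b..max a b})" for t
      unfolding F_def has_real_derivative_iff_has_vector_derivative[symmetric]
      using pos[of t] nz[of t] y
      by (auto intro!: derivative_eq_intros simp: divide_simps) (simp add: algebra_simps)
  qed
  then have "(LINT t:{a<..<b}|lborel. (x - t) / ((x - t)\<^sup>2 + y\<^sup>2)) = F b - F a"
    using ab by (simp add: interval_integral_Ioo)
  also have "\<dots> = ln (cmod (Complex x y - a)) - ln (cmod (Complex x y - b))"
    by (simp add: ln_cmod)
  also have "\<dots> = ln (cmod (Complex x y - a) / cmod (Complex x y - b))"
    using y by (subst ln_div) (auto simp: complex_eq_iff)
  finally show ?thesis by (simp add: norm_divide)
qed

lemma conjugate_poisson_kernel_bound: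
  fixes s y :: real
  assumes "y > 0"
  shows "\<bar>s / (s\<^sup>2 + y\<^sup>2)\<bar> \<le> 1 / (2 * y)"
proof -
  have "2 * y * \<bar>s\<bar> \<le> s\<^sup>2 + y\<^sup>2"
    using zero_le_power2[of "\<bar>s\<bar> - y"] by (simp add: power2_diff algebra_simps)
  moreover have "s\<^sup>2 + y\<^sup>2 > 0" using assms by (intro add_nonneg_pos) auto
  ultimately show ?thesis using assms by (simp add: abs_divide field_simps)
qed

lemma integrable_bounded_on_finite_measure:
  fixes g :: "'a \<Rightarrow> real"
  assumes "A \<in> sets M" "emeasure M A < \<infinity>" "g \<in> borel_measurable M" "\<And>x. \<bar>g x\<bar> \<le> K"
  shows "set_integrable M A g"
  unfolding set_integrable_def
  by (rule integrableI_bounded_set_indicator[where B = K]) (use assms in auto)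

text \<open>
  On an interval \<open>(\<alpha>, \<beta>)\<close> the integral of the conjugate Poisson kernel is
  \<open>ln \<bar>(z - \<alpha>) / (z - \<beta>)\<bar>\<close> with \<open>z = x + \<i> y\<close>.  Summing over the intervals that make up the set turns
  the sum into the logarithm of the factorised rational function.
\<close>

lemma set_integral_conjugate_poisson_boole_set:
  fixes b m :: "'i \<Rightarrow> real"
  assumes I: "finite I" and m: "\<And>i. i \<in> I \<Longrightarrow> 0 < m i" and y: "y > 0"
  shows "(LINT t:boole_set I b m 1|lborel. (x - t) / ((x - t)\<^sup>2 + y\<^sup>2)) =
    ln (cmod (1 + (\<Sum>i\<in>I. m i / (Complex x y - b i))))"
proof -
  obtain n :: nat and \<alpha> \<beta> where ab: "\<forall>i<n. \<alpha> i < \<beta> i"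
    "\<forall>i j. i < j \<longrightarrow> j < n \<longrightarrow> \<beta> i < \<alpha> j"
    "boole_set I b m 1 = (\<Union>i<n. {\<alpha> i<..<\<beta> i})"
    "\<forall>z::complex. Im z \<noteq> 0 \<longrightarrow> 1 + (\<Sum>i\<in>I. m i / (z - b i)) = (\<Prod>i<n. (z - \<alpha> i) / (z - \<beta> i))"
    by (rule boole_set_intervals[OF I m, where b = b])
  let ?k = "\<lambda>t. (x - t) / ((x - t)\<^sup>2 + y\<^sup>2)"
  have nz: "Complex x y \<noteq> complex_of_real r" for r using y by (auto simp: complex_eq_iff)
  have "(LINT t:boole_set I b m 1|lborel. ?k t) = (\<Sum>i<n. LINT t:{\<alpha> i<..<\<beta> i}|lborel. ?k t)"
    unfolding ab(3) using disjoint_interlacing_intervals[of n \<beta> \<alpha>] ab(1,2)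
    by (intro set_integral_finite_Union integrable_bounded_on_finite_measure[where K = "1 / (2*y)"]
          conjugate_poisson_kernel_bound y) (auto simp: less_imp_le)
  also have "\<dots> = (\<Sum>i<n. ln (cmod ((Complex x y - \<alpha> i) / (Complex x y - \<beta> i))))"
    using ab(1) y by (intro sum.cong refl set_integral_conjugate_poisson_interval) auto
  also have "\<dots> = ln (\<Prod>i<n. cmod ((Complex x y - \<alpha> i) / (Complex x y - \<beta> i)))"
    using nz by (intro ln_prod[symmetric]) auto
  also have "\<dots> = ln (cmod (1 + (\<Sum>i\<in>I. m i / (Complex x y - b i))))"
    using ab(4)[rule_format, of "Complex x y"] y by (simp add: prod_norm)
  finally show ?thesis .
qed

section \<open>Passing to infinitely many poles\<close>

text \<open>
  Completeness of the measure algebra: the lower limit of the sets differs from \<open>E n\<close> only on the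
  union of the later symmetric differences, whose measure is a tail of a convergent series.
\<close>

lemma limit_of_summable_sym_diff:
  fixes E :: "nat \<Rightarrow> 'a set" and s :: "nat \<Rightarrow> real"
  assumes E: "\<And>n. E n \<in> sets M" and fin: "emeasure M (E 0) < \<infinity>"
    and s: "summable s" "\<And>n. 0 \<le> s n"
    and diff: "\<And>n. emeasure M (sym_diff (E n) (E (Suc n))) \<le> ennreal (s n)"
  obtains L where "L \<in> sets M" "emeasure M L < \<infinity>"
    "(\<lambda>n. measure M (sym_diff (E n) L)) \<longlonglongrightarrow> 0"
proof -
  define L where "L = (\<Union>N. \<Inter>n\<in>{N..}. E n)"
  define D where "D n = sym_diff (E n) (E (Suc n))" for n
  have L: "L \<in> sets M" unfolding L_def using E by (intro sets.countable_UN sets.countable_INT) auto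
  have D: "D n \<in> sets M" for n unfolding D_def using E by auto
  have sub: "sym_diff (E n) L \<subseteq> (\<Union>k. D (k + n))" for n
  proof (rule ccontr)
    assume "\<not> ?thesis"
    then obtain x where x: "x \<in> sym_diff (E n) L" and no: "\<And>k. x \<notin> D (k + n)" by auto
    have same: "x \<in> E (k + n) \<longleftrightarrow> x \<in> E n" for k
    proof (induction k)
      case (Suc k)
      then show ?case using no[of k] by (auto simp: D_def)
    qed simp
    have same': "x \<in> E k \<longleftrightarrow> x \<in> E n" if "n \<le> k" for k using same[of "k - n"] that by simp
    have "x \<in> L \<longleftrightarrow> x \<in> E n"
    proof
      assume "x \<in> L"
      then obtain N where "\<And>k. k \<ge> N \<Longrightarrow> x \<in> E k" by (auto simp: L_def)
      then have "x \<in> E (max N n)" by simp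
      then show "x \<in> E n" using same'[of "max N n"] by simp
    next
      assume "x \<in> E n"
      then have "x \<in> E k" if "n \<le> k" for k using same'[OF that] by blast
      then show "x \<in> L" by (auto simp: L_def)
    qed
    then show False using x by auto
  qed
  have le: "emeasure M (sym_diff (E n) L) \<le> ennreal (\<Sum>k. s (k + n))" for n
  proof -
    have "emeasure M (sym_diff (E n) L) \<le> emeasure M (\<Union>k. D (k + n))"
      by (intro emeasure_mono sub) (use D in auto)
    also have "\<dots> \<le> (\<Sum>k. emeasure M (D (k + n)))"
      using D by (intro emeasure_subadditive_countably) auto
    also have "\<dots> \<le> (\<Sum>k. ennreal (s (k + n)))"
      using diff by (intro suminf_le) (auto simp: D_def)
    also have "\<dots> = ennreal (\<Sum>k. s (k + n))"
      using s summable_iff_shift[of s n] by (intro suminf_ennreal2) auto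
    finally show ?thesis .
  qed
  have nonneg: "0 \<le> (\<Sum>k. s (k + n))" for n
    using s summable_iff_shift[of s n] by (intro suminf_nonneg) auto
  have "emeasure M L \<le> emeasure M (E 0 \<union> sym_diff (E 0) L)"
    using E L by (intro emeasure_mono) auto
  also have "\<dots> \<le> emeasure M (E 0) + emeasure M (sym_diff (E 0) L)"
    using E L by (intro emeasure_subadditive) auto
  also have "\<dots> < \<infinity>" using fin le_less_trans[OF le[of 0]] by (simp add: ennreal_add_eq_top less_top)
  finally have "emeasure M L < \<infinity>" .
  moreover have "(\<lambda>n. measure M (sym_diff (E n) L)) \<longlonglongrightarrow> 0"
  proof (rule tendsto_sandwich[OF _ _ tendsto_const suminf_exist_split2[OF s(1)]])
    show "\<forall>\<^sub>F n in sequentially. measure M (sym_diff (E n) L) \<le> (\<Sum>k. s (k + n))"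
      using le nonneg by (intro always_eventually allI) (auto simp: measure_def intro!: enn2real_leI)
  qed auto
  ultimately show ?thesis using that L by blast
qed

lemma tendsto_set_integral_sym_diff:
  fixes g :: "'a \<Rightarrow> real"
  assumes E: "\<And>n. E n \<in> sets M" "\<And>n. emeasure M (E n) < \<infinity>"
    and L: "L \<in> sets M" "emeasure M L < \<infinity>"
    and lim: "(\<lambda>n. measure M (sym_diff (E n) L)) \<longlonglongrightarrow> 0"
    and g: "g \<in> borel_measurable M" "\<And>x. \<bar>g x\<bar> \<le> K"
  shows "(\<lambda>n. LINT x:E n|M. g x) \<longlonglongrightarrow> (LINT x:L|M. g x)"
proof (rule LIM_zero_cancel, rule Lim_null_comparison)
  show "(\<lambda>n. K * measure M (sym_diff (E n) L)) \<longlonglongrightarrow> 0"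
    using tendsto_mult_right_zero[OF lim] by simp
  have K: "0 \<le> K" using g(2)[of undefined] by linarith
  show "\<forall>\<^sub>F n in sequentially. norm ((LINT x:E n|M. g x) - (LINT x:L|M. g x)) \<le> K * measure M (sym_diff (E n) L)"
  proof (intro always_eventually allI)
    fix n
    let ?D = "sym_diff (E n) L"
    have fin: "emeasure M ?D < \<infinity>"
    proof -
      have "emeasure M ?D \<le> emeasure M (E n \<union> L)" using E L by (intro emeasure_mono) auto
      also have "\<dots> \<le> emeasure M (E n) + emeasure M L" using E L by (intro emeasure_subadditive) auto
      also have "\<dots> < \<infinity>" using E(2)[of n] L(2) by (simp add: ennreal_add_eq_top less_top)
      finally show ?thesis .
    qed
    have int: "set_integrable M (E n) g" "set_integrable M L g"
      using integrable_bounded_on_finite_measure E L g by blast+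
    have "(LINT x:E n|M. g x) - (LINT x:L|M. g x) = (LINT x|M. indicator (E n) x * g x - indicator L x * g x)"
      using int by (simp add: set_lebesgue_integral_def set_integrable_def)
    also have "norm \<dots> \<le> (LINT x|M. norm (indicator (E n) x * g x - indicator L x * g x))"
      by (rule integral_norm_bound)
    also have "\<dots> \<le> (LINT x|M. K * indicator ?D x)"
    proof (rule integral_mono)
      show "integrable M (\<lambda>x. norm (indicator (E n) x * g x - indicator L x * g x))"
        using int by (auto simp: set_integrable_def)
      show "integrable M (\<lambda>x. K * indicator ?D x)"
        using fin E L by (intro integrable_mult_right integrable_real_indicator) auto
      show "norm (indicator (E n) x * g x - indicator L x * g x) \<le> K * indicator ?D x" for x
        using g(2)[of x] K by (auto simp: indicator_def)
    qed
    also have "\<dots> = K * measure M ?D"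
      using E(1)[of n] L(1) by (simp add: Int_absorb2 sets.sets_into_space)
    finally show "norm ((LINT x:E n|M. g x) - (LINT x:L|M. g x)) \<le> K * measure M ?D" .
  qed
qed

text \<open>
  Adding poles changes the set by little, however these poles lie.  A point that enters has
  either a contribution below \<open>- \<delta>\<close> from the new poles, or had a value in \<open>[0, \<delta>)\<close> before; Boole's
  identity measures the first kind directly and the second as the difference of two levels.  The
  points that leave need no separate estimate: the total measure does not decrease, so there are
  no more of them than of those that enter.
\<close>

lemma emeasure_sym_diff_boole_set_le:
  fixes b m :: "'i \<Rightarrow> real"
  assumes J: "finite J" and sub: "I \<subseteq> J" and m: "\<And>i. i \<in> J \<Longrightarrow> 0 < m i" and \<delta>: "0 < \<delta>" "\<delta> \<le> 1/2"
  shows "emeasure lborel (sym_diff (boole_set I b m 1) (boole_set J b m 1))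
    \<le> ennreal (2 * (sum m (J - I) / \<delta> + 2 * \<delta> * sum m I))"
proof -
  let ?A = "boole_set I b m 1" and ?B = "boole_set J b m 1"
  let ?\<mu> = "measure lborel"
  let ?r = "sum m (J - I) / \<delta> + 2 * \<delta> * sum m I"
  have I: "finite I" by (rule finite_subset[OF sub J])
  have mI: "\<And>i. i \<in> I \<Longrightarrow> 0 < m i" and mJI: "\<And>i. i \<in> J - I \<Longrightarrow> 0 < m i" using m sub by auto
  have fm: "boole_set I' b m c \<in> fmeasurable lborel" if "I' \<subseteq> J" "0 < c" for I' c
  proof (rule fmeasurableI)
    have "finite I'" by (rule finite_subset[OF that(1) J])
    then show "boole_set I' b m c \<in> sets lborel" by (simp add: sets_boole_set)
    show "emeasure lborel (boole_set I' b m c) < \<infinity>"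
      by (subst emeasure_boole_set) (use \<open>finite I'\<close> that m in auto)
  qed
  have bs: "boole_set I' b m c \<in> sets borel" if "I' \<subseteq> J" for I' c
    by (rule sets_boole_set[OF finite_subset[OF that J]])
  have nonneg: "0 \<le> sum m I" using mI by (intro sum_nonneg) (auto intro: less_imp_le)
  have BA: "?B - ?A \<subseteq> boole_set (J - I) b m \<delta> \<union> (boole_set I b m (1 - \<delta>) - ?A)"
  proof
    fix x assume x: "x \<in> ?B - ?A"
    have split: "(\<Sum>i\<in>J. m i / (x - b i)) = (\<Sum>i\<in>J - I. m i / (x - b i)) + (\<Sum>i\<in>I. m i / (x - b i))"
      using sum.subset_diff[OF sub J] by simp
    have J: "x \<notin> b ` J" and neg: "1 + (\<Sum>i\<in>J. m i / (x - b i)) < 0"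
      using x by (simp_all add: boole_set_def)
    have out: "x \<notin> b ` I" "x \<notin> b ` (J - I)" using J sub by auto
    show "x \<in> boole_set (J - I) b m \<delta> \<union> (boole_set I b m (1 - \<delta>) - ?A)"
    proof (cases "\<delta> + (\<Sum>i\<in>J - I. m i / (x - b i)) < 0")
      case True
      then show ?thesis using out by (simp add: boole_set_def)
    next
      case False
      then have "1 - \<delta> + (\<Sum>i\<in>I. m i / (x - b i)) < 0" using neg split by linarith
      then show ?thesis using out x by (simp add: boole_set_def)
    qed
  qed
  have A_sub: "?A \<subseteq> boole_set I b m (1 - \<delta>)" using \<delta> by (auto simp: boole_set_def)
  have "?\<mu> (boole_set I b m (1 - \<delta>) - ?A) = ?\<mu> (boole_set I b m (1 - \<delta>)) - ?\<mu> ?A"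
    using A_sub fm[OF sub] bs[OF sub] \<delta> by (intro measurable_measure_Diff) (auto simp: fmeasurableD)
  also have "\<dots> = sum m I * (\<delta> / (1 - \<delta>))"
    using measure_boole_set[OF I mI, where c = 1 and b = b]
      measure_boole_set[OF I mI, where c = "1 - \<delta>" and b = b] \<delta>
    by (simp add: field_simps)
  also have "\<dots> \<le> sum m I * (2 * \<delta>)"
    using \<delta> nonneg by (intro mult_left_mono) (auto simp: field_simps)
  finally have gap: "?\<mu> (boole_set I b m (1 - \<delta>) - ?A) \<le> 2 * \<delta> * sum m I" by (simp add: mult_ac)
  let ?G = "boole_set I b m (1 - \<delta>) - ?A" and ?N = "boole_set (J - I) b m \<delta>"
  have fA: "?A \<in> fmeasurable lborel" by (rule fm[OF sub]) simp
  have fB: "?B \<in> fmeasurable lborel" by (rule fm) simp_all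
  have fN: "?N \<in> fmeasurable lborel" by (rule fm) (use \<delta> in auto)
  have fG: "?G \<in> fmeasurable lborel"
    by (intro fmeasurable.Diff fA fm[OF sub]) (use \<delta> in auto)
  have "?\<mu> (?B - ?A) \<le> ?\<mu> (?N \<union> ?G)"
    by (rule measure_mono_fmeasurable[OF BA]) (intro fmeasurableD fmeasurable.Diff fmeasurable.Un fA fB fN fG)+
  also have "\<dots> \<le> ?\<mu> ?N + ?\<mu> ?G"
    by (intro measure_Un_le fmeasurableD fN fG)
  also have "\<dots> \<le> ?r"
  proof -
    have "?\<mu> ?N = sum m (J - I) / \<delta>"
      by (rule measure_boole_set) (use J mJI \<delta> in auto)
    then show ?thesis using gap by simp
  qed
  finally have BA_le: "?\<mu> (?B - ?A) \<le> ?r" .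
  have "?\<mu> ?B + ?\<mu> (?A - ?B) = ?\<mu> ?A + ?\<mu> (?B - ?A)"
  proof -
    have fin: "emeasure lborel ?A \<noteq> top" "emeasure lborel ?B \<noteq> top"
      "emeasure lborel (?A - ?B) \<noteq> top" "emeasure lborel (?B - ?A) \<noteq> top"
      using fA fB fmeasurable.Diff[OF fA fB] fmeasurable.Diff[OF fB fA] fmeasurableD2 by auto
    have "?\<mu> ?B + ?\<mu> (?A - ?B) = ?\<mu> (?B \<union> (?A - ?B))"
      by (intro measure_Union[symmetric]) (use fin bs[OF sub, of 1] bs[of J 1] in auto)
    also have "?B \<union> (?A - ?B) = ?A \<union> (?B - ?A)" by auto
    also have "?\<mu> \<dots> = ?\<mu> ?A + ?\<mu> (?B - ?A)"
      by (intro measure_Union) (use fin bs[OF sub, of 1] bs[of J 1] in auto)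
    finally show ?thesis .
  qed
  moreover have "?\<mu> ?A \<le> ?\<mu> ?B"
  proof -
    have "sum m I \<le> sum m J" using J sub m by (intro sum_mono2) (auto intro: less_imp_le)
    moreover have "?\<mu> ?A = sum m I" using measure_boole_set[OF I mI, where c = 1 and b = b] by simp
    moreover have "?\<mu> ?B = sum m J" using measure_boole_set[OF J m, where c = 1 and b = b] by simp
    ultimately show ?thesis by simp
  qed
  ultimately have AB_le: "?\<mu> (?A - ?B) \<le> ?r" using BA_le by linarith
  have "?\<mu> (sym_diff ?A ?B) \<le> ?\<mu> (?A - ?B) + ?\<mu> (?B - ?A)"
    using bs[OF sub, of 1] bs[of J 1] by (intro measure_Un_le) auto
  also have "\<dots> \<le> 2 * ?r" using AB_le BA_le by simp
  finally have "?\<mu> (sym_diff ?A ?B) \<le> 2 * ?r" .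
  moreover have "sym_diff ?A ?B \<in> fmeasurable lborel" using fA fB by auto
  ultimately show ?thesis by (simp add: emeasure_eq_measure2 ennreal_leI)
qed

text \<open>
  All terms of the imaginary part have the same sign: up to this sign it is the Poisson extension
  of the measure with mass \<open>m i\<close> at \<open>b i\<close>, so each atom alone bounds the modulus from below.
\<close>

lemma poisson_sum_le_cmod_cauchy_transform:
  fixes b m :: "nat \<Rightarrow> real"
  assumes m: "\<And>i. 0 < m i" "summable m" and y: "y > 0"
  shows "summable (\<lambda>i. complex_of_real (m i) / (Complex x y - b i))" (is "summable ?c")
    and "m j * y / ((x - b j)\<^sup>2 + y\<^sup>2) \<le> cmod (1 + (\<Sum>i. complex_of_real (m i) / (Complex x y - b i)))"
proof -
  have bound: "norm (?c i) \<le> m i / y" for i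
  proof -
    have "y \<le> cmod (Complex x y - b i)" using abs_Im_le_cmod[of "Complex x y - b i"] y by simp
    then show ?thesis using m(1)[of i] y by (simp add: norm_divide frac_le)
  qed
  show c: "summable ?c"
    by (rule summable_comparison_test'[OF summable_divide[OF m(2), of y] bound])
  define p where "p i = m i * y / ((x - b i)\<^sup>2 + y\<^sup>2)" for i
  have Im_c: "Im (?c i) = - p i" for i
    by (simp add: p_def Im_divide)
  have p0: "0 \<le> p i" for i using m(1)[of i] y by (simp add: p_def)
  have "(\<lambda>i. Im (?c i)) sums Im (\<Sum>i. ?c i)" by (rule sums_Im[OF summable_sums[OF c]])
  then have "p sums (- Im (\<Sum>i. ?c i))" unfolding Im_c using sums_minus by fastforce
  then have "p j \<le> - Im (\<Sum>i. ?c i)"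
    using sum_le_suminf[of p "{j}"] p0 by (auto simp: sums_iff)
  also have "\<dots> \<le> cmod (1 + (\<Sum>i. ?c i))"
    using abs_Im_le_cmod[of "1 + (\<Sum>i. ?c i)"] by simp
  finally show "m j * y / ((x - b j)\<^sup>2 + y\<^sup>2) \<le> cmod (1 + (\<Sum>i. ?c i))" by (simp add: p_def)
qed

text \<open>
  The ratio \<open>1/4\<close> leaves a summable bound after division by \<open>\<delta> = (1/2) ^ Suc k\<close> in
  \<open>emeasure_sym_diff_boole_set_le\<close>.
\<close>

lemma summable_imp_geometric_blocks:
  fixes m :: "nat \<Rightarrow> real"
  assumes m: "\<And>i. 0 < m i" "summable m"
  obtains r :: "nat \<Rightarrow> nat" where "\<forall>k. k \<le> r k" "\<forall>k. r k \<le> r (Suc k)"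
    "\<forall>k. sum m ({..<r (Suc k)} - {..<r k}) \<le> (1/4) ^ k"
proof -
  have "\<forall>k. \<exists>N. \<forall>n\<ge>N. norm (\<Sum>i. m (i + n)) < (1/4) ^ k"
    by (intro allI suminf_exist_split[OF _ m(2)]) simp
  from choice[OF this] obtain f where f: "\<forall>k. \<forall>n\<ge>f k. norm (\<Sum>i. m (i + n)) < (1/4) ^ k"
    by (elim exE)
  define r where "r k = k + (\<Sum>j\<le>k. f j)" for k
  have rf: "f k \<le> r k" for k
    using member_le_sum[of k "{..k}" f] by (simp add: r_def)
  show ?thesis
  proof
    show "\<forall>k. k \<le> r k" by (simp add: r_def)
    show le: "\<forall>k. r k \<le> r (Suc k)" by (simp add: r_def)
    show "\<forall>k. sum m ({..<r (Suc k)} - {..<r k}) \<le> (1/4) ^ k"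
    proof
      fix k
      have "sum m ({..<r (Suc k)} - {..<r k}) = sum m {..<r (Suc k)} - sum m {..<r k}"
        using le by (intro sum_diff) auto
      also have "\<dots> \<le> suminf m - sum m {..<r k}"
        using m by (simp add: sum_le_suminf less_imp_le)
      also have "\<dots> = (\<Sum>i. m (i + r k))"
        by (rule suminf_minus_initial_segment[OF m(2), symmetric])
      also have "\<dots> \<le> (1/4) ^ k" using f[rule_format, OF rf[of k]] by (simp add: abs_less_iff)
      finally show "sum m ({..<r (Suc k)} - {..<r k}) \<le> (1/4) ^ k" .
    qed
  qed
qed

text \<open>
  The sets belonging to the first \<open>r k\<close> atoms form a fast Cauchy sequence in measure.  Their limit
  is again a set, not merely a function with values in \<open>[0, 1]\<close>, and as the conjugate Poisson kernel
  is bounded for fixed \<open>y\<close>, the logarithmic formula passes to the limit.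
\<close>

lemma exists_set_with_log_cauchy_transform:
  fixes b m :: "nat \<Rightarrow> real"
  assumes m: "\<And>i. 0 < m i" "summable m"
  obtains E where "E \<in> sets borel" "emeasure lborel E < \<infinity>"
    "\<forall>x y. 0 < y \<longrightarrow> (LINT t:E|lborel. (x - t) / ((x - t)\<^sup>2 + y\<^sup>2)) =
       ln (cmod (1 + (\<Sum>i. complex_of_real (m i) / (Complex x y - b i))))"
proof -
  obtain r where r: "\<forall>k. k \<le> r k" "\<forall>k. r k \<le> r (Suc k)"
    "\<forall>k. sum m ({..<r (Suc k)} - {..<r k}) \<le> (1/4) ^ k"
    by (rule summable_imp_geometric_blocks[OF m])
  define A where "A k = boole_set {..<r k} b m 1" for k
  define S where "S = suminf m"
  have S: "sum m {..<n} \<le> S" for n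
    unfolding S_def using m by (intro sum_le_suminf) (auto intro: less_imp_le)
  have S0: "0 \<le> S" using S[of 0] by simp
  have A_sets: "A k \<in> sets lborel" for k
    by (simp add: A_def sets_boole_set)
  have A_fin: "emeasure lborel (A k) < \<infinity>" for k
    unfolding A_def by (subst emeasure_boole_set) (use m in auto)
  have diff: "emeasure lborel (sym_diff (A k) (A (Suc k))) \<le> ennreal ((4 + 2 * S) * (1/2) ^ k)" for k
  proof -
    define \<delta> :: real where "\<delta> = (1/2) ^ Suc k"
    have \<delta>: "0 < \<delta>" "\<delta> \<le> 1/2" by (simp_all add: \<delta>_def power_le_one)
    have "emeasure lborel (sym_diff (A k) (A (Suc k)))
        \<le> ennreal (2 * (sum m ({..<r (Suc k)} - {..<r k}) / \<delta> + 2 * \<delta> * sum m {..<r k}))"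
      unfolding A_def using r(2) m(1) \<delta> by (intro emeasure_sym_diff_boole_set_le) auto
    also have "\<dots> \<le> ennreal (2 * ((1/4) ^ k / \<delta> + 2 * \<delta> * S))"
      using r(3) S \<delta>
      by (intro ennreal_leI mult_left_mono add_mono divide_right_mono) auto
    also have "2 * ((1/4) ^ k / \<delta> + 2 * \<delta> * S) = (4 + 2 * S) * (1/2) ^ k"
    proof -
      have "(1/4 :: real) ^ k = (1/2) ^ k * (1/2) ^ k" by (simp flip: power_mult_distrib)
      then have "(1/4 :: real) ^ k / \<delta> = 2 * (1/2) ^ k" by (simp add: \<delta>_def)
      then show ?thesis by (simp add: \<delta>_def algebra_simps)
    qed
    finally show ?thesis .
  qed
  obtain E where E: "E \<in> sets lborel" "emeasure lborel E < \<infinity>"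
    "(\<lambda>k. measure lborel (sym_diff (A k) E)) \<longlonglongrightarrow> 0"
  proof (rule limit_of_summable_sym_diff[of A lborel "\<lambda>k. (4 + 2 * S) * (1/2) ^ k"])
    show "summable (\<lambda>k. (4 + 2 * S) * (1/2) ^ k)"
      by (intro summable_mult summable_geometric) simp
    show "0 \<le> (4 + 2 * S) * (1/2) ^ k" for k using S0 by simp
  qed (use A_sets A_fin diff in auto)
  have "(LINT t:E|lborel. (x - t) / ((x - t)\<^sup>2 + y\<^sup>2)) =
      ln (cmod (1 + (\<Sum>i. complex_of_real (m i) / (Complex x y - b i))))" if y: "0 < y" for x y
  proof (rule LIMSEQ_unique)
    let ?c = "\<lambda>i. complex_of_real (m i) / (Complex x y - b i)"
    show "(\<lambda>k. LINT t:A k|lborel. (x - t) / ((x - t)\<^sup>2 + y\<^sup>2))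
        \<longlonglongrightarrow> (LINT t:E|lborel. (x - t) / ((x - t)\<^sup>2 + y\<^sup>2))"
      by (rule tendsto_set_integral_sym_diff[OF A_sets A_fin E _ conjugate_poisson_kernel_bound[OF y]])
        measurable
    have "(\<lambda>n. \<Sum>i<n. ?c i) \<longlonglongrightarrow> (\<Sum>i. ?c i)"
      by (rule summable_LIMSEQ[OF poisson_sum_le_cmod_cauchy_transform(1)[OF m y]])
    moreover have "filterlim r at_top sequentially"
      using r(1) by (intro filterlim_at_top_mono[OF filterlim_ident]) auto
    ultimately have "(\<lambda>k. \<Sum>i<r k. ?c i) \<longlonglongrightarrow> (\<Sum>i. ?c i)"
      by (rule filterlim_compose)
    \<comment> \<open>The logarithm is continuous at the limit because the imaginary part does not vanish.\<close>
    moreover have "cmod (1 + (\<Sum>i. ?c i)) \<noteq> 0"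
    proof -
      have "0 < m 0 * y / ((x - b 0)\<^sup>2 + y\<^sup>2)"
        using m(1)[of 0] y by (intro divide_pos_pos mult_pos_pos add_nonneg_pos) auto
      then show ?thesis
        using poisson_sum_le_cmod_cauchy_transform(2)[OF m y, where x = x and b = b and j = 0] by linarith
    qed
    ultimately have "(\<lambda>k. ln (cmod (1 + (\<Sum>i<r k. ?c i)))) \<longlonglongrightarrow> ln (cmod (1 + (\<Sum>i. ?c i)))"
      by (intro tendsto_intros)
    then show "(\<lambda>k. LINT t:A k|lborel. (x - t) / ((x - t)\<^sup>2 + y\<^sup>2))
        \<longlonglongrightarrow> ln (cmod (1 + (\<Sum>i. ?c i)))"
      unfolding A_def using m(1) y by (simp add: set_integral_conjugate_poisson_boole_set)
  qed
  then show ?thesis using that E by simp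
qed

section \<open>Truncated Hilbert transform and conjugate Poisson integral\<close>

lemma has_bochner_integral_poisson_kernel:
  fixes x y :: real
  assumes "y > 0"
  shows "has_bochner_integral lborel (\<lambda>t. y / ((x - t)\<^sup>2 + y\<^sup>2)) pi"
proof -
  have "has_bochner_integral lborel (\<lambda>u::real. inverse (1 + u\<^sup>2)) pi"
    using integrable_inverse_1_plus_square LBINT_inverse_1_plus_square
    by (simp add: has_bochner_integral_iff interval_lebesgue_integral_def set_integrable_def
        set_lebesgue_integral_def)
  then have "has_bochner_integral lborel (\<lambda>t. inverse (1 + (- x / y + 1 / y * t)\<^sup>2)) (pi /\<^sub>R \<bar>1 / y\<bar>)"
    using assms by (subst (asm) lborel_has_bochner_integral_real_affine_iff[of "1 / y" _ _ "- x / y"]) auto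
  then have "has_bochner_integral lborel (\<lambda>t. 1 / y * inverse (1 + (- x / y + 1 / y * t)\<^sup>2)) (1 / y * (pi /\<^sub>R \<bar>1 / y\<bar>))"
    by (rule has_bochner_integral_mult_right)
  also have "1 / y * (pi /\<^sub>R \<bar>1 / y\<bar>) = pi" using assms by simp
  also have "(\<lambda>t. 1 / y * inverse (1 + (- x / y + 1 / y * t)\<^sup>2)) = (\<lambda>t. y / ((x - t)\<^sup>2 + y\<^sup>2))"
  proof
    fix t
    have "1 + (- x / y + 1 / y * t)\<^sup>2 = ((x - t)\<^sup>2 + y\<^sup>2) / y\<^sup>2"
      using assms by (simp add: field_simps power2_eq_square)
    then show "1 / y * inverse (1 + (- x / y + 1 / y * t)\<^sup>2) = y / ((x - t)\<^sup>2 + y\<^sup>2)"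
      using assms by (simp add: power2_eq_square)
  qed
  finally show ?thesis .
qed

text \<open>
  The Poisson kernel dominates the difference on both sides of the truncation, and its integral
  does not depend on \<open>y\<close>.  Hence for indicator functions the two transforms differ by a constant
  at most, uniformly in the set, the point and the scale.
\<close>

lemma truncated_kernel_minus_conjugate_poisson_kernel:
  fixes s y :: real
  assumes "y > 0"
  shows "\<bar>(if \<bar>s\<bar> > y then 1 / s else 0) - s / (s\<^sup>2 + y\<^sup>2)\<bar> \<le> y / (s\<^sup>2 + y\<^sup>2)"
proof -
  have pos: "s\<^sup>2 + y\<^sup>2 > 0" using assms by (intro add_nonneg_pos) auto
  show ?thesis
  proof (cases "\<bar>s\<bar> > y")
    case True
    then have "s \<noteq> 0" using assms by auto
    then have "1 / s - s / (s\<^sup>2 + y\<^sup>2) = y / (s\<^sup>2 + y\<^sup>2) * (y / s)"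
      using pos by (simp add: field_simps power2_eq_square)
    also have "\<bar>\<dots>\<bar> \<le> y / (s\<^sup>2 + y\<^sup>2) * 1"
      unfolding abs_mult using True assms pos \<open>s \<noteq> 0\<close>
      by (intro mult_mono) (auto simp: abs_divide field_simps)
    finally show ?thesis using True by simp
  next
    case False
    then show ?thesis using assms pos by (simp add: abs_divide divide_right_mono)
  qed
qed

lemma truncated_hilbert_indicator_near_conjugate_poisson:
  assumes E: "E \<in> sets borel" "emeasure lborel E < \<infinity>" and y: "y > 0"
  shows "\<bar>pi * truncated_hilbert y (indicat_real E) x - (LINT t:E|lborel. (x - t) / ((x - t)\<^sup>2 + y\<^sup>2))\<bar> \<le> pi"
proof -
  define T where "T t = (if \<bar>x - t\<bar> > y then 1 / (x - t) else 0)" for t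
  define Q where "Q t = (x - t) / ((x - t)\<^sup>2 + y\<^sup>2)" for t
  have meas [measurable]: "T \<in> borel_measurable borel" "Q \<in> borel_measurable borel" "E \<in> sets borel"
    using E(1) unfolding T_def Q_def by measurable
  have "pi * truncated_hilbert y (indicat_real E) x = (LINT t|lebesgue. indicator E t * T t)"
    by (auto simp: truncated_hilbert_def set_lebesgue_integral_def T_def indicator_def abs_minus_commute
        intro!: Bochner_Integration.integral_cong)
  also have "\<dots> = (LINT t|lborel. indicator E t * T t)"
    by (rule integral_completion) measurable
  finally have H: "pi * truncated_hilbert y (indicat_real E) x = (LINT t|lborel. indicator E t * T t)" .
  have "set_integrable lborel E T"
  proof (rule integrable_bounded_on_finite_measure)
    show "\<bar>T t\<bar> \<le> 1 / y" for t using y by (auto simp: T_def abs_divide intro!: divide_left_mono)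
  qed (use E in auto)
  moreover have "set_integrable lborel E Q"
    unfolding Q_def
    by (rule integrable_bounded_on_finite_measure[OF _ _ _ conjugate_poisson_kernel_bound]) (use E y in auto)
  ultimately have int: "integrable lborel (\<lambda>t. indicator E t * T t)" "integrable lborel (\<lambda>t. indicator E t * Q t)"
    by (simp_all add: set_integrable_def)
  have P: "has_bochner_integral lborel (\<lambda>t. y / ((x - t)\<^sup>2 + y\<^sup>2)) pi"
    by (rule has_bochner_integral_poisson_kernel[OF y])
  have "pi * truncated_hilbert y (indicat_real E) x - (LINT t:E|lborel. Q t)
      = (LINT t|lborel. indicator E t * T t - indicator E t * Q t)"
    using int by (simp add: H set_lebesgue_integral_def)
  also have "\<bar>\<dots>\<bar> \<le> (LINT t|lborel. \<bar>indicator E t * T t - indicator E t * Q t\<bar>)"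
    by (rule integral_abs_bound)
  also have "\<dots> \<le> (LINT t|lborel. y / ((x - t)\<^sup>2 + y\<^sup>2))"
  proof (rule integral_mono)
    show "\<bar>indicator E t * T t - indicator E t * Q t\<bar> \<le> y / ((x - t)\<^sup>2 + y\<^sup>2)" for t
      using truncated_kernel_minus_conjugate_poisson_kernel[OF y, of "x - t"] y
      by (auto simp: T_def Q_def indicator_def)
  qed (use int P in \<open>auto simp: has_bochner_integral_iff\<close>)
  also have "\<dots> = pi" using P by (simp add: has_bochner_integral_iff)
  finally show ?thesis by (simp add: Q_def)
qed

section \<open>A finite measure with large Poisson extension on a null set\<close>

text \<open>
  The covering intervals have disjoint interiors, so their lengths add up to the measure of the
  union.  The summable increment \<open>\<eta> / 2 * (1/2) ^ Suc i\<close> makes all radii positive and provides for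
  enumerations of a finite cover, which are continued by the degenerate interval \<open>{0}\<close>.
\<close>

lemma null_set_centred_interval_cover:
  fixes S :: "real set"
  assumes S: "S \<in> null_sets lebesgue" "S \<subseteq> {l..r}" and \<eta>: "0 < \<eta>"
  obtains c w :: "nat \<Rightarrow> real" where "\<And>i. 0 < w i" "\<And>n. (\<Sum>i<n. w i) \<le> \<eta>"
    "\<And>x. x \<in> S \<Longrightarrow> \<exists>i. \<bar>x - c i\<bar> \<le> w i"
proof -
  let ?\<mu> = "measure lebesgue"
  have Sm: "S \<in> lmeasurable" "?\<mu> S = 0"
    using S(1) by (auto simp: null_sets_def fmeasurable_def measure_def)
  obtain D where D: "countable D" "\<And>K. K \<in> D \<Longrightarrow> K \<subseteq> cbox l r \<and> K \<noteq> {} \<and> (\<exists>c d. K = cbox c d)"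
    "pairwise (\<lambda>A B. interior A \<inter> interior B = {}) D" "S \<subseteq> \<Union>D" "\<Union>D \<in> lmeasurable"
    "?\<mu> (\<Union>D) \<le> ?\<mu> S + \<eta> / 2"
    using measurable_outer_intervals_bounded[OF Sm(1), of l r "\<eta> / 2"] S(2) \<eta>
    by (metis box_real(2) half_gt_zero)
  have box: "\<exists>u v. u \<le> v \<and> K = {u..v}" if K: "K \<in> D" for K
  proof -
    have ne: "K \<noteq> {}" and "\<exists>u v. K = cbox u v" using D(2)[OF K] by simp_all
    then obtain u v where uv: "K = {u..v}" by (elim exE) simp
    have "u \<le> v" using ne unfolding uv by simp
    then show ?thesis by (intro exI[of _ u] exI[of _ v] conjI uv)
  qed
  have fin_sum: "sum ?\<mu> F \<le> \<eta> / 2" if F: "finite F" "F \<subseteq> D" for F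
  proof -
    have int: "interior K \<in> lmeasurable" "?\<mu> (interior K) = ?\<mu> K" if K: "K \<in> F" for K
    proof -
      obtain u v where "u \<le> v" "K = {u..v}" using box[OF subsetD[OF F(2) K]] by blast
      then show "interior K \<in> lmeasurable" "?\<mu> (interior K) = ?\<mu> K"
        by (simp_all add: interior_atLeastAtMost_real)
    qed
    have "sum ?\<mu> F = (\<Sum>K\<in>F. ?\<mu> (interior K))" using int by simp
    also have "\<dots> = ?\<mu> (\<Union>K\<in>F. interior K)"
    proof (intro measure_finite_Union[symmetric] F(1))
      show "interior ` F \<subseteq> sets lebesgue" using int(1) by (auto dest: fmeasurableD)
      show "disjoint_family_on interior F"
        using pairwise_subset[OF D(3) F(2)] by (simp add: disjoint_family_on_def pairwise_def)
      show "emeasure lebesgue (interior K) \<noteq> \<infinity>" if "K \<in> F" for K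
        using fmeasurableD2[OF int(1)[OF that]] by simp
    qed
    also have "\<dots> \<le> ?\<mu> (\<Union>D)"
    proof (rule measure_mono_fmeasurable[OF _ _ D(5)])
      show "(\<Union>K\<in>F. interior K) \<subseteq> \<Union>D" using F(2) interior_subset by fastforce
      show "(\<Union>K\<in>F. interior K) \<in> sets lebesgue"
        by (intro sets.finite_UN F(1) fmeasurableD int)
    qed
    finally show ?thesis using D(6) Sm(2) by simp
  qed
  define N where "N = to_nat_on D ` D"
  define K where "K i = (if i \<in> N then from_nat_into D i else {0})" for i
  define c where "c i = (SOME x. x \<in> K i)" for i
  define w where "w i = ?\<mu> (K i) + \<eta> / 2 * (1/2) ^ Suc i" for i
  have KD: "K i \<in> D" if "i \<in> N" for i
    using that D(1) by (auto simp: N_def K_def)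
  have inj: "inj_on K N"
    using D(1) by (auto simp: inj_on_def N_def K_def)
  have sumK: "(\<Sum>i<n. ?\<mu> (K i)) \<le> \<eta> / 2" for n
  proof -
    have "(\<Sum>i<n. ?\<mu> (K i)) = (\<Sum>i\<in>{..<n} \<inter> N. ?\<mu> (K i))"
      by (intro sum.mono_neutral_right) (auto simp: K_def)
    also have "\<dots> = sum ?\<mu> (K ` ({..<n} \<inter> N))"
      using inj by (subst sum.reindex) (auto intro: inj_on_subset)
    also have "\<dots> \<le> \<eta> / 2" using KD by (intro fin_sum) auto
    finally show ?thesis .
  qed
  show ?thesis
  proof
    show "0 < w i" for i using \<eta> by (simp add: w_def add_nonneg_pos)
    show "(\<Sum>i<n. w i) \<le> \<eta>" for n
    proof -
      have "(\<Sum>i<n. (1/2::real) ^ Suc i) = 1 - (1/2) ^ n"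
        by (induction n) (auto simp: field_simps)
      also have "\<dots> \<le> 1" by simp
      finally have "\<eta> / 2 * (\<Sum>i<n. (1/2) ^ Suc i) \<le> \<eta> / 2 * 1"
        using \<eta> by (intro mult_left_mono) auto
      then show ?thesis using sumK[of n]
        by (simp only: w_def sum.distrib sum_distrib_left[symmetric])
    qed
    fix x assume "x \<in> S"
    then obtain B where B: "B \<in> D" "x \<in> B" using D(4) by auto
    define i where "i = to_nat_on D B"
    have Ki: "K i = B" using B D(1) by (simp add: K_def N_def i_def)
    obtain u v where uv: "u \<le> v" "B = {u..v}" using box[OF B(1)] by auto
    have "c i \<in> K i" unfolding c_def by (rule someI[of _ x]) (simp add: Ki B)
    then have "\<bar>x - c i\<bar> \<le> v - u" using B uv Ki by auto
    also have "\<dots> \<le> w i" using uv Ki \<eta> by (simp add: w_def)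
    finally show "\<exists>i. \<bar>x - c i\<bar> \<le> w i" by blast
  qed
qed

text \<open>
  For each \<open>p\<close>, cover the part of \<open>e\<close> in \<open>[-p, p]\<close> by intervals of total radius \<open>(1/4) ^ p\<close> and put at
  each centre an atom of mass \<open>2 ^ p\<close> times the radius.  The total mass is finite, while a point of
  \<open>e\<close> is covered for all large \<open>p\<close> and so meets atoms of arbitrarily high density.
\<close>

lemma null_set_heavy_atoms:
  fixes e :: "real set"
  assumes e: "e \<in> null_sets lebesgue"
  obtains b m :: "nat \<Rightarrow> real" where "\<forall>i. 0 < m i" "summable m"
    "\<forall>x\<in>e. \<forall>K. \<exists>i y. 0 < y \<and> \<bar>x - b i\<bar> \<le> y \<and> K * y \<le> m i"
proof -
  have "\<exists>c w :: nat \<Rightarrow> real. (\<forall>i. 0 < w i) \<and> (\<forall>n. (\<Sum>i<n. w i) \<le> (1/4) ^ p) \<and>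
      (\<forall>x\<in>e. \<bar>x\<bar> \<le> real p \<longrightarrow> (\<exists>i. \<bar>x - c i\<bar> \<le> w i))" for p :: nat
  proof -
    have "e \<inter> {- real p..real p} \<in> null_sets lebesgue"
      using e null_sets_subset[OF e, of "e \<inter> {- real p..real p}"] by (auto intro!: null_set_Int2)
    then obtain c w :: "nat \<Rightarrow> real" where "\<And>i. 0 < w i" "\<And>n. (\<Sum>i<n. w i) \<le> (1/4) ^ p"
      "\<And>x. x \<in> e \<inter> {- real p..real p} \<Longrightarrow> \<exists>i. \<bar>x - c i\<bar> \<le> w i"
      by (rule null_set_centred_interval_cover[where l = "- real p" and r = "real p" and \<eta> = "(1/4) ^ p"])
        auto
    then show ?thesis by (intro exI[of _ c] exI[of _ w]) (auto simp: abs_le_iff)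
  qed
  then obtain c w :: "nat \<Rightarrow> nat \<Rightarrow> real" where cw: "\<And>p i. 0 < w p i" "\<And>p n. (\<Sum>i<n. w p i) \<le> (1/4) ^ p"
      "\<And>p x. x \<in> e \<Longrightarrow> \<bar>x\<bar> \<le> real p \<Longrightarrow> \<exists>i. \<bar>x - c p i\<bar> \<le> w p i"
    by metis
  define M where "M = (\<lambda>(p, i). 2 ^ p * w p i)"
  define b where "b j = (case prod_decode j of (p, i) \<Rightarrow> c p i)" for j
  define m where "m j = M (prod_decode j)" for j
  have Mpos: "0 < M q" for q using cw(1) by (auto simp: M_def split: prod.split)
  show ?thesis
  proof
    show "\<forall>j. 0 < m j" using Mpos by (simp add: m_def)
    show "summable m"
    proof (rule summableI_nonneg_bounded)
      show "0 \<le> m j" for j using Mpos by (simp add: m_def less_imp_le)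
      show "sum m {..<n} \<le> 2" for n
      proof -
        have sub: "prod_decode ` {..<n} \<subseteq> {..<n} \<times> {..<n}"
        proof (rule image_subsetI)
          fix j assume "j \<in> {..<n}"
          moreover have "fst (prod_decode j) \<le> j" "snd (prod_decode j) \<le> j"
            using le_prod_encode_1[of "fst (prod_decode j)" "snd (prod_decode j)"]
              le_prod_encode_2[of "snd (prod_decode j)" "fst (prod_decode j)"] by simp_all
          ultimately show "prod_decode j \<in> {..<n} \<times> {..<n}" by (auto simp: mem_Times_iff)
        qed
        have "sum m {..<n} = sum M (prod_decode ` {..<n})"
          unfolding m_def using inj_prod_decode by (subst sum.reindex) (auto intro: inj_on_subset)
        also have "\<dots> \<le> sum M ({..<n} \<times> {..<n})"
          by (intro sum_mono2 sub) (use Mpos in \<open>auto intro: less_imp_le\<close>)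
        also have "\<dots> = (\<Sum>p<n. 2 ^ p * (\<Sum>i<n. w p i))"
          by (simp add: M_def sum.cartesian_product sum_distrib_left)
        also have "\<dots> \<le> (\<Sum>p<n. 2 ^ p * (1/4) ^ p)"
          by (intro sum_mono mult_left_mono cw(2)) auto
        also have "\<dots> = (\<Sum>p<n. (1/2) ^ p)" by (simp flip: power_mult_distrib)
        also have "\<dots> = 2 - 2 * (1/2) ^ n" by (induction n) (auto simp: field_simps)
        also have "\<dots> \<le> 2" by simp
        finally show ?thesis .
      qed
    qed
    show "\<forall>x\<in>e. \<forall>K. \<exists>j y. 0 < y \<and> \<bar>x - b j\<bar> \<le> y \<and> K * y \<le> m j"
    proof (intro ballI allI)
      fix x K :: real assume x: "x \<in> e"
      obtain p1 :: nat where p1: "\<bar>x\<bar> \<le> real p1" using real_arch_simple by blast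
      obtain p2 :: nat where p2: "K < 2 ^ p2" using real_arch_pow[of 2 K] by auto
      define p where "p = max p1 p2"
      have K: "K \<le> 2 ^ p"
      proof -
        have "(2::real) ^ p2 \<le> 2 ^ p" by (rule power_increasing) (auto simp: p_def)
        then show ?thesis using p2 by linarith
      qed
      have "\<bar>x\<bar> \<le> real p" using p1 by (simp add: p_def)
      then obtain i where i: "\<bar>x - c p i\<bar> \<le> w p i" using cw(3)[OF x] by blast
      show "\<exists>j y. 0 < y \<and> \<bar>x - b j\<bar> \<le> y \<and> K * y \<le> m j"
        using i cw(1)[of p i] K
        by (intro exI[of _ "prod_encode (p, i)"] exI[of _ "w p i"]) (simp add: b_def m_def M_def mult_right_mono)
    qed
  qed
qed

section \<open>Divergence on a null set\<close>

lemma ennreal_top_if_unbounded: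
  assumes "\<And>R. ennreal R \<le> X"
  shows "X = top"
proof (rule ccontr)
  assume "X \<noteq> top"
  then obtain r where r: "X = ennreal r" "0 \<le> r" by (cases X) auto
  then show False using assms[of "r + 1"] by (simp add: ennreal_le_iff)
qed

theorem theorem1:
  fixes e :: "real set"
  assumes "e \<in> null_sets lebesgue"
  shows "\<exists>E :: real set. E \<in> sets lebesgue \<and> emeasure lebesgue E < \<infinity> \<and>
           (\<forall>x\<in>e. maximal_hilbert (indicat_real E) x = \<infinity>)"
proof -
  obtain b m :: "nat \<Rightarrow> real" where m': "\<forall>i. 0 < m i" and m2: "summable m"
    and heavy: "\<forall>x\<in>e. \<forall>K. \<exists>i y. 0 < y \<and> \<bar>x - b i\<bar> \<le> y \<and> K * y \<le> m i"
    by (rule null_set_heavy_atoms[OF assms])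
  have m: "\<And>i. 0 < m i" "summable m" using m' m2 by auto
  obtain E where E: "E \<in> sets borel" "emeasure lborel E < \<infinity>"
    and log: "\<forall>x y. 0 < y \<longrightarrow> (LINT t:E|lborel. (x - t) / ((x - t)\<^sup>2 + y\<^sup>2)) =
       ln (cmod (1 + (\<Sum>i. complex_of_real (m i) / (Complex x y - b i))))"
    by (rule exists_set_with_log_cauchy_transform[OF m])
  have "maximal_hilbert (indicat_real E) x = \<infinity>" if x: "x \<in> e" for x
  proof -
    have "ennreal R \<le> maximal_hilbert (indicat_real E) x" for R
    proof -
      \<comment> \<open>At distance at most \<open>y\<close> from an atom of mass at least \<open>K * y\<close> the Poisson extension at
        height \<open>y\<close> is at least \<open>K / 2\<close>; the \<open>+ 1\<close> pays for replacing the conjugate Poisson kernel by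
        the truncated one.\<close>
      define K where "K = 2 * exp (pi * (R + 1))"
      obtain i y where y: "0 < y" "\<bar>x - b i\<bar> \<le> y" "K * y \<le> m i"
        using heavy x by blast
      have sq: "(x - b i)\<^sup>2 \<le> y\<^sup>2" using y power_mono[of "\<bar>x - b i\<bar>" y 2] by simp
      have pos: "0 < (x - b i)\<^sup>2 + y\<^sup>2" using y(1) by (intro add_nonneg_pos) auto
      have "K / 2 = K * y * y / (2 * y\<^sup>2)" using y(1) by (simp add: power2_eq_square)
      also have "\<dots> \<le> m i * y / ((x - b i)\<^sup>2 + y\<^sup>2)"
        using y sq pos m(1)[of i] by (intro frac_le mult_right_mono) auto
      also have "\<dots> \<le> cmod (1 + (\<Sum>i. complex_of_real (m i) / (Complex x y - b i)))"
        by (rule poisson_sum_le_cmod_cauchy_transform(2)[OF m y(1)])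
      finally have "exp (pi * (R + 1)) \<le> cmod (1 + (\<Sum>i. complex_of_real (m i) / (Complex x y - b i)))"
        by (simp add: K_def)
      then have "pi * (R + 1) \<le> (LINT t:E|lborel. (x - t) / ((x - t)\<^sup>2 + y\<^sup>2))"
        unfolding log[rule_format, OF y(1)] by (subst ln_ge_iff) (auto intro: less_le_trans[OF exp_gt_zero])
      then have "pi * R \<le> pi * truncated_hilbert y (indicat_real E) x"
        using truncated_hilbert_indicator_near_conjugate_poisson[OF E y(1), of x]
        unfolding distrib_left by linarith
      then have "R \<le> \<bar>truncated_hilbert y (indicat_real E) x\<bar>" by simp
      then have "ennreal R \<le> ennreal \<bar>truncated_hilbert y (indicat_real E) x\<bar>" by (rule ennreal_leI)
      also have "\<dots> \<le> maximal_hilbert (indicat_real E) x"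
        unfolding maximal_hilbert_def using y(1) by (intro SUP_upper) simp
      finally show ?thesis .
    qed
    then show ?thesis using ennreal_top_if_unbounded by simp
  qed
  moreover have "E \<in> sets lebesgue" "emeasure lebesgue E < \<infinity>"
    using E by auto
  ultimately show ?thesis by blast
qed

end
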